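(* Let $n\geq 8$ and let $a_0,a_1,a_2,a_3\in\mathbb{Z}$ satisfy $a_{i+1}-a_i\geq 2$ for $i=0,1,2$ and $a_3-a_0\leq n-2$. Then the complex $$\langle [\![a_3,a_2-1]\!],\ [\![a_2,a_1-1]\!],\ [\![a_1,a_0-1]\!],\ [\![a_0,a_3-1]\!]\rangle$$ on $I_n$ is a minimal complex generating $\mathsf{Mon}_n$.
   Context: For finite sets $A,I$, a language is a subset $L\subseteq A^I$. For finite sets $B,J$ and a function $f:B^J\to A^I$, the input window $\mathcal{W}_f(i)\subseteq J$ of $i\in I$ is the smallest $W\subseteq J$ such that for all $x,y\in B^J$ agreeing on $W$, $f(x)_i=f(y)_i$. The communication complex $K_f$ is the simplicial complex on vertex set $I$ whose simplices are the sets $S\subseteq I$ with $\bigcap_{i\in S}\mathcal{W}_f(i)\neq\emptyset$. A simplicial complex $K$ on $I$ generates $L$ if there exist finite sets $B,J$ and $f:B^J\to A^I$ with $f(B^J)=L$ and $K_f\subseteq K$; $K$ is minimal generating $L$ if it generates $L$ and no complex properly contained in $K$ generates $L$. $\mathsf{Mon}_n\subseteq\{0,1\}^n$ is the set of binary strings $x_0\ldots x_{n-1}$ that are non-decreasing or non-increasing. Positions $I_n=\{0,\ldots,n-1\}$ are identified with $\mathbb{Z}/n\mathbb{Z}$. For $a,b\in\mathbb{Z}$, the interval $[\![a,b]\!]=\{c\bmod n: c\in\mathbb{Z},\ a\leq c\leq b'\}$ where $b'$ is the representative of $b$ modulo $n$ with $a\leq b'<a+n$. $\langle S_0,\ldots,S_k\rangle$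 denotes the simplicial complex whose maximal simplices are $S_0,\ldots,S_k$. *)

theory Defs
  imports "HOL-Library.FuncSet"
begin

text \<open>
  For sets \<open>A\<close>, \<open>I\<close> the set of families \<open>A\<^sup>I\<close> is \<open>I \<rightarrow>\<^sub>E A\<close>, so that a family is determined by its
  values on \<open>I\<close>.
\<close>

definition determines :: "'b set \<Rightarrow> 'j set \<Rightarrow> (('j \<Rightarrow> 'b) \<Rightarrow> 'i \<Rightarrow> 'a) \<Rightarrow> 'i \<Rightarrow> 'j set \<Rightarrow> bool" where
  "determines B J f i W \<longleftrightarrow>
     (\<forall>x \<in> J \<rightarrow>\<^sub>E B. \<forall>y \<in> J \<rightarrow>\<^sub>E B. (\<forall>j\<in>W. x j = y j) \<longrightarrow> f x i = f y i)"

text \<open>The order on sets is inclusion; the least such set exists when \<open>J\<close> is finite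
  (\<open>input_window_least\<close> below).\<close>

definition input_window :: "'b set \<Rightarrow> 'j set \<Rightarrow> (('j \<Rightarrow> 'b) \<Rightarrow> 'i \<Rightarrow> 'a) \<Rightarrow> 'i \<Rightarrow> 'j set" where
  "input_window B J f i = (LEAST W. W \<subseteq> J \<and> determines B J f i W)"

lemma determines_Int:
  assumes W: "W \<subseteq> J" "determines B J f i W" and W': "determines B J f i W'"
  shows "determines B J f i (W \<inter> W')"
  unfolding determines_def
proof (intro ballI impI)
  fix x y assume x: "x \<in> J \<rightarrow>\<^sub>E B" and y: "y \<in> J \<rightarrow>\<^sub>E B" and eq: "\<forall>j\<in>W \<inter> W'. x j = y j"
  define z where "z j = (if j \<in> W then x j else y j)" for j
  have z: "z \<in> J \<rightarrow>\<^sub>E B"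
    using x y W(1) by (auto simp: z_def PiE_iff extensional_def)
  have "\<forall>j\<in>W. x j = z j" by (simp add: z_def)
  then have "f x i = f z i"
    using W(2) x z unfolding determines_def by blast
  moreover have "\<forall>j\<in>W'. z j = y j" using eq by (simp add: z_def)
  then have "f z i = f y i"
    using W' y z unfolding determines_def by blast
  ultimately show "f x i = f y i" by simp
qed

lemma input_window_least:
  fixes J :: "'j set"
  assumes "finite J"
  shows "input_window B J f i \<subseteq> J" (is ?sub)
    and "determines B J f i (input_window B J f i)" (is ?det)
    and "W \<subseteq> J \<Longrightarrow> determines B J f i W \<Longrightarrow> input_window B J f i \<subseteq> W"
proof -
  define F where "F = {W. W \<subseteq> J \<and> determines B J f i W}"
  have fin: "finite F" using assms by (auto simp: F_def)
  have "f x i = f y i" if "x \<in> J \<rightarrow>\<^sub>E B" "y \<in> J \<rightarrow>\<^sub>E B" "\<forall>j\<in>J. x j = y j" for x y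
  proof -
    have "x = y" using that by (intro PiE_ext[OF that(1,2)]) auto
    then show ?thesis by simp
  qed
  then have "determines B J f i J" unfolding determines_def by blast
  then have J: "J \<in> F" by (simp add: F_def)
  have "\<Inter>G \<in> F" if "finite G" "G \<noteq> {}" "G \<subseteq> F" for G
    using that
  proof (induction G rule: finite_ne_induct)
    case (singleton W)
    then show ?case by simp
  next
    case (insert W G)
    then have "W \<in> F" "\<Inter>G \<in> F" by auto
    then have "W \<inter> \<Inter>G \<in> F" using determines_Int[of W J B f i "\<Inter>G"] by (auto simp only: F_def)
    then show ?case by simp
  qed
  from this[of F] have "\<Inter>F \<in> F" using fin J by blast
  have "input_window B J f i = \<Inter>F"
    unfolding input_window_def
  proof (rule Least_equality)
    show "\<Inter>F \<subseteq> J \<and> determines B J f i (\<Inter>F)"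
      using \<open>\<Inter>F \<in> F\<close> unfolding F_def by (rule CollectD)
    show "\<Inter>F \<subseteq> W" if "W \<subseteq> J \<and> determines B J f i W" for W
      by (rule Inter_lower) (use that in \<open>simp add: F_def\<close>)
  qed
  note eq = this
  show ?sub ?det using \<open>\<Inter>F \<in> F\<close> unfolding eq by (simp_all add: F_def)
  show "input_window B J f i \<subseteq> W" if "W \<subseteq> J" "determines B J f i W"
    unfolding eq by (rule Inter_lower) (use that in \<open>simp add: F_def\<close>)
qed

text \<open>A complex is the set of its simplices. The empty set is admitted as a simplex, and not every
  \<open>i \<in> I\<close> need be a simplex \<open>{i}\<close> (for instance, an \<open>i\<close> with empty input window is not).\<close>

definition simplicial_complex_on :: "'i set \<Rightarrow> 'i set set \<Rightarrow> bool" where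
  "simplicial_complex_on I K \<longleftrightarrow> K \<subseteq> Pow I \<and> (\<forall>S\<in>K. \<forall>T\<subseteq>S. T \<in> K)"

text \<open>The intersection is taken inside \<open>J\<close>, which only matters for \<open>S = {}\<close>.\<close>

definition communication_complex ::
    "'i set \<Rightarrow> 'b set \<Rightarrow> 'j set \<Rightarrow> (('j \<Rightarrow> 'b) \<Rightarrow> 'i \<Rightarrow> 'a) \<Rightarrow> 'i set set" where
  "communication_complex I B J f =
     {S. S \<subseteq> I \<and> J \<inter> (\<Inter>i\<in>S. input_window B J f i) \<noteq> {}}"

text \<open>The finite sets \<open>B\<close> and \<open>J\<close> are existentially quantified; since a definition cannot quantify
  over types, they are taken to be sets of natural numbers. By \<open>generatesI\<close> below this is no
  restriction.\<close>

definition generates :: "'i set \<Rightarrow> 'a set \<Rightarrow> 'i set set \<Rightarrow> ('i \<Rightarrow> 'a) set \<Rightarrow> bool" where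
  "generates I A K L \<longleftrightarrow>
     (\<exists>(B :: nat set) (J :: nat set) f.
        finite B \<and> finite J \<and> f \<in> (J \<rightarrow>\<^sub>E B) \<rightarrow> (I \<rightarrow>\<^sub>E A) \<and>
        f ` (J \<rightarrow>\<^sub>E B) = L \<and> communication_complex I B J f \<subseteq> K)"

lemma generatesI:
  fixes B :: "'b set" and J :: "'j set"
  assumes fin: "finite B" "finite J" and f: "f \<in> (J \<rightarrow>\<^sub>E B) \<rightarrow> (I \<rightarrow>\<^sub>E A)"
    and img: "f ` (J \<rightarrow>\<^sub>E B) = L" and K: "communication_complex I B J f \<subseteq> K"
  shows "generates I A K L"
proof -
  obtain \<beta> where \<beta>: "bij_betw \<beta> B {0..<card B}"
    using fin(1) ex_bij_betw_finite_nat by blast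
  obtain \<gamma> where \<gamma>: "bij_betw \<gamma> J {0..<card J}"
    using fin(2) ex_bij_betw_finite_nat by blast
  define B' where "B' = {0..<card B}"
  define J' where "J' = {0..<card J}"
  define dec where "dec y = (\<lambda>j\<in>J. inv_into B \<beta> (y (\<gamma> j)))" for y
  define g where "g y = f (dec y)" for y
  have dec: "dec y \<in> J \<rightarrow>\<^sub>E B" if "y \<in> J' \<rightarrow>\<^sub>E B'" for y
  proof -
    have "inv_into B \<beta> (y (\<gamma> j)) \<in> B" if "j \<in> J" for j
      using \<open>y \<in> J' \<rightarrow>\<^sub>E B'\<close> that \<beta> \<gamma>
      by (metis B'_def J'_def PiE_mem bij_betw_def image_eqI inv_into_into)
    then show ?thesis by (auto simp: dec_def)
  qed
  have surj: "\<exists>y \<in> J' \<rightarrow>\<^sub>E B'. dec y = x" if x: "x \<in> J \<rightarrow>\<^sub>E B" for x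
  proof
    let ?y = "\<lambda>k\<in>J'. \<beta> (x (inv_into J \<gamma> k))"
    have inv: "inv_into J \<gamma> k \<in> J" if "k \<in> J'" for k
      using that \<gamma> by (metis J'_def bij_betw_def inv_into_into)
    show "?y \<in> J' \<rightarrow>\<^sub>E B'"
      using PiE_mem[OF x] inv \<beta> by (auto simp: B'_def bij_betw_def)
    have mem: "\<gamma> j \<in> J'" if "j \<in> J" for j
      using \<gamma> that by (auto simp: J'_def bij_betw_def)
    have "dec ?y j = x j" for j
    proof (cases "j \<in> J")
      case True
      then show ?thesis
        using PiE_mem[OF x True] mem[OF True] \<beta> \<gamma> by (simp add: dec_def bij_betw_def)
    next
      case False
      then show ?thesis using PiE_arb[OF x False] by (simp add: dec_def)
    qed
    then show "dec ?y = x" by (rule ext)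
  qed
  have img': "g ` (J' \<rightarrow>\<^sub>E B') = L"
    unfolding img[symmetric]
  proof (intro equalityI subsetI)
    fix z assume "z \<in> g ` (J' \<rightarrow>\<^sub>E B')"
    then obtain y where y: "y \<in> J' \<rightarrow>\<^sub>E B'" and z: "z = f (dec y)" unfolding g_def by (rule imageE)
    show "z \<in> f ` (J \<rightarrow>\<^sub>E B)" unfolding z using dec[OF y] by (rule imageI)
  next
    fix z assume "z \<in> f ` (J \<rightarrow>\<^sub>E B)"
    then obtain x where x: "x \<in> J \<rightarrow>\<^sub>E B" and z: "z = f x" by (rule imageE)
    obtain y where y: "y \<in> J' \<rightarrow>\<^sub>E B'" and "dec y = x" using surj[OF x] by (rule bexE)
    then have "z = g y" by (simp only: z g_def)
    then show "z \<in> g ` (J' \<rightarrow>\<^sub>E B')" using y by (rule image_eqI)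
  qed
  have g: "g \<in> (J' \<rightarrow>\<^sub>E B') \<rightarrow> (I \<rightarrow>\<^sub>E A)" unfolding g_def by (rule Pi_I) (rule funcset_mem[OF f dec])
  have win: "input_window B' J' g i \<subseteq> \<gamma> ` input_window B J f i" for i
  proof (rule input_window_least(3))
    note W = input_window_least[OF fin(2), where B = B and f = f and i = i]
    show "finite J'" by (simp add: J'_def)
    show "\<gamma> ` input_window B J f i \<subseteq> J'"
      using W(1) \<gamma> by (auto simp: J'_def bij_betw_def)
    show "determines B' J' g i (\<gamma> ` input_window B J f i)"
      unfolding determines_def
    proof (intro ballI impI)
      fix x y assume "x \<in> J' \<rightarrow>\<^sub>E B'" "y \<in> J' \<rightarrow>\<^sub>E B'"
        and "\<forall>k\<in>\<gamma> ` input_window B J f i. x k = y k"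
      then have "\<forall>j\<in>input_window B J f i. dec x j = dec y j" by (auto simp: dec_def)
      then show "g x i = g y i"
        using W(2) dec[OF \<open>x \<in> J' \<rightarrow>\<^sub>E B'\<close>] dec[OF \<open>y \<in> J' \<rightarrow>\<^sub>E B'\<close>]
        unfolding g_def determines_def by blast
    qed
  qed
  have "communication_complex I B' J' g \<subseteq> communication_complex I B J f"
  proof
    fix S assume "S \<in> communication_complex I B' J' g"
    then obtain k where S: "S \<subseteq> I" and k: "k \<in> J'" "\<forall>i\<in>S. k \<in> input_window B' J' g i"
      by (auto simp: communication_complex_def)
    have "k \<in> \<gamma> ` J" using k(1) \<gamma> by (simp add: J'_def bij_betw_def)
    then obtain j where j: "j \<in> J" "k = \<gamma> j" by blast
    have "j \<in> input_window B J f i" if "i \<in> S" for i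
    proof -
      have "k \<in> \<gamma> ` input_window B J f i" using k(2) that by (intro subsetD[OF win]) (rule bspec)
      then obtain j' where "j' \<in> input_window B J f i" "k = \<gamma> j'" by (rule imageE)
      from \<open>j' \<in> input_window B J f i\<close> have "j' \<in> J" by (rule subsetD[OF input_window_least(1)[OF fin(2)]])
      have "\<gamma> j' = \<gamma> j" using \<open>k = \<gamma> j'\<close> j(2) by (rule subst)
      then have "j' = j"
        using \<open>j' \<in> J\<close> j(1) by (rule inj_onD[OF bij_betw_imp_inj_on[OF \<gamma>]])
      with \<open>j' \<in> input_window B J f i\<close> show ?thesis by simp
    qed
    then have "j \<in> J \<inter> (\<Inter>i\<in>S. input_window B J f i)" using j(1) by (intro IntI INT_I)
    then show "S \<in> communication_complex I B J f"
      unfolding communication_complex_def using S by blast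
  qed
  then have "communication_complex I B' J' g \<subseteq> K" using K by (rule subset_trans)
  moreover have "finite B'" "finite J'" by (simp_all add: B'_def J'_def)
  ultimately show ?thesis
    unfolding generates_def using g img' by (intro exI[of _ B'] exI[of _ J'] exI[of _ g] conjI)
qed

definition minimal_generating :: "'i set \<Rightarrow> 'a set \<Rightarrow> 'i set set \<Rightarrow> ('i \<Rightarrow> 'a) set \<Rightarrow> bool" where
  "minimal_generating I A K L \<longleftrightarrow>
     simplicial_complex_on I K \<and> generates I A K L \<and>
     (\<forall>K'. simplicial_complex_on I K' \<and> K' \<subset> K \<longrightarrow> \<not> generates I A K' L)"

text \<open>\<open>complex_of F\<close> is \<open>\<langle>S\<^sub>0, \<dots>, S\<^sub>k\<rangle>\<close> for \<open>F = {S\<^sub>0, \<dots>, S\<^sub>k}\<close>.\<close>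

definition complex_of :: "'i set set \<Rightarrow> 'i set set" where
  "complex_of F = {S. \<exists>T\<in>F. S \<subseteq> T}"

lemma maximal_simplices_complex_of:
  assumes "\<And>S T. S \<in> F \<Longrightarrow> T \<in> F \<Longrightarrow> S \<subseteq> T \<Longrightarrow> S = T"
  shows "{S \<in> complex_of F. \<forall>T\<in>complex_of F. S \<subseteq> T \<longrightarrow> S = T} = F"
proof (intro equalityI subsetI)
  fix S assume "S \<in> {S \<in> complex_of F. \<forall>T\<in>complex_of F. S \<subseteq> T \<longrightarrow> S = T}"
  then show "S \<in> F" unfolding complex_of_def by blast
next
  fix S assume S: "S \<in> F"
  have "S = T" if "T \<in> complex_of F" "S \<subseteq> T" for T
    using that assms[OF S] unfolding complex_of_def by blast
  with S show "S \<in> {S \<in> complex_of F. \<forall>T\<in>complex_of F. S \<subseteq> T \<longrightarrow> S = T}"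
    unfolding complex_of_def by blast
qed

definition Mon :: "nat \<Rightarrow> (nat \<Rightarrow> nat) set" where
  "Mon n = {x \<in> {0..<n} \<rightarrow>\<^sub>E {0, 1}. mono_on {0..<n} x \<or> antimono_on {0..<n} x}"

text \<open>\<open>a + (b - a) mod n\<close> is the representative of \<open>b\<close> modulo \<open>n\<close> in \<open>{a..<a + n}\<close>.\<close>

definition cyc_interval :: "nat \<Rightarrow> int \<Rightarrow> int \<Rightarrow> nat set" where
  "cyc_interval n a b = {nat (c mod int n) | c. a \<le> c \<and> c \<le> a + (b - a) mod int n}"

end

theory Submission
  imports Defs
begin

text \<open>
  Extending a word by \<open>x (i + n) = 1 - x i\<close> turns the monotone words into the indicators of the
  half-circles \<open>{p, \<dots>, p + n - 1}\<close> of \<open>\<int>/2n\<close>, so \<open>Mon n\<close> is invariant under twisted rotations. The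
  complex consists of the sets that miss one of the four blocks \<open>A\<^sub>k = {a\<^sub>k, \<dots>, a\<^sub>k\<^sub>+\<^sub>1 - 1}\<close>.

  Generation: there is one input per block, ignored by that block, and the letters of a block are
  constant, with the sign of a weighted sum of the signs of the three inputs read, except in the
  case of a tie, where one input says after how many letters the block switches.

  Minimality: by rotation, suppose that no input is read by the whole complement of \<open>A\<^sub>0\<close>. Take
  inputs \<open>w\<close>, \<open>s\<close> and \<open>v\<close> whose words switch inside \<open>A\<^sub>1\<close>, \<open>A\<^sub>3\<close> and \<open>A\<^sub>2\<close>. In every mixture that
  takes the coordinates missed by \<open>A\<^sub>1\<close> or \<open>A\<^sub>3\<close> from \<open>v\<close>, the word vanishes on \<open>A\<^sub>0\<close>. If the other
  coordinates come from \<open>s\<close>, the word is 1 from \<open>a\<^sub>1\<close> on; if they come from \<open>w\<close>, it is 0 up to the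
  end of \<open>A\<^sub>3\<close>. Changing the coordinates missed by \<open>A\<^sub>0\<close> and some position \<open>m\<close> from \<open>s\<close> to \<open>w\<close> in
  increasing order of \<open>m\<close> in the first mixture, and in the second from \<open>w\<close> to \<open>s\<close> in decreasing
  order, makes both agree on everything that \<open>a\<^sub>2\<close> reads, while the letters there still differ.
\<close>

section \<open>Antiperiodic extensions and half-circles\<close>

definition antiperiodic :: "nat \<Rightarrow> (int \<Rightarrow> bool) \<Rightarrow> bool" where
  "antiperiodic n F \<longleftrightarrow> (\<forall>c. F (c + int n) = (\<not> F c))"

text \<open>Letters become truth values; an equation with \<open>even\<close> complements its other
  side once per odd number of turns.\<close>

definition lift :: "nat \<Rightarrow> (nat \<Rightarrow> nat) \<Rightarrow> int \<Rightarrow> bool" where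
  "lift n x c \<longleftrightarrow> (x (nat (c mod int n)) = 1) = even (c div int n)"

definition word :: "nat \<Rightarrow> (int \<Rightarrow> bool) \<Rightarrow> nat \<Rightarrow> nat" where
  "word n F = (\<lambda>i\<in>{0..<n}. if F (int i) then 1 else 0)"

definition half :: "nat \<Rightarrow> int \<Rightarrow> int \<Rightarrow> bool" where
  "half n p c \<longleftrightarrow> (c - p) mod (2 * int n) < int n"

text \<open>The right end is not reduced modulo \<open>n\<close>, so an arc may be empty and its
  ends can be compared as integers.\<close>

definition arc :: "nat \<Rightarrow> int \<Rightarrow> int \<Rightarrow> nat set" where
  "arc n a b = {nat (c mod int n) | c. a \<le> c \<and> c < b}"

lemma antiperiodic_lift: "n > 0 \<Longrightarrow> antiperiodic n (lift n x)"
  by (auto simp: antiperiodic_def lift_def div_add_self2)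

lemma antiperiodic_add: "antiperiodic n F \<Longrightarrow> F (c + int n) \<longleftrightarrow> \<not> F c"
  by (simp add: antiperiodic_def)

lemma antiperiodic_diff: "antiperiodic n F \<Longrightarrow> F (c - int n) \<longleftrightarrow> \<not> F c"
  using antiperiodic_add[of n F "c - int n"] by auto

lemma antiperiodic_mult:
  assumes "antiperiodic n F"
  shows "F (c + k * int n) \<longleftrightarrow> F c = even k"
proof (induction k rule: int_induct[where k = 0])
  case (step1 k)
  then show ?case
    using antiperiodic_add[OF assms, of "c + k * int n"] by (auto simp: algebra_simps)
next
  case (step2 k)
  then show ?case
    using antiperiodic_diff[OF assms, of "c + k * int n"] by (auto simp: algebra_simps)
qed simp

lemma antiperiodic_eqI:
  assumes "n > 0" "antiperiodic n F" "antiperiodic n G"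
    and eq: "\<And>c. r \<le> c \<Longrightarrow> c < r + int n \<Longrightarrow> F c = G c"
  shows "F = G"
proof
  fix c
  define k where "k = (c - r) div int n"
  define d where "d = r + (c - r) mod int n"
  have c: "c = d + k * int n" by (simp add: d_def k_def)
  have "F d = G d" by (rule eq) (use assms(1) in \<open>simp_all add: d_def\<close>)
  then show "F c = G c"
    unfolding c by (simp add: antiperiodic_mult assms)
qed

lemma lift_word:
  assumes "n > 0" "antiperiodic n F"
  shows "lift n (word n F) = F"
proof
  fix c
  have "nat (c mod int n) < n" using assms(1) by (simp add: nat_less_iff)
  then have "lift n (word n F) c \<longleftrightarrow> F (c mod int n) = even (c div int n)"
    using assms(1) by (simp add: lift_def word_def)
  also have "\<dots> \<longleftrightarrow> F (c mod int n + (c div int n) * int n)"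
    by (simp only: antiperiodic_mult[OF assms(2)])
  finally show "lift n (word n F) c = F c" by simp
qed

lemma mod_less_double:
  fixes r m :: int
  assumes "0 \<le> r" "r < 2 * m"
  shows "r mod m = (if r < m then r else r - m)"
  using assms minus_mod_self2[of r m] by (auto simp del: minus_mod_self2)

lemma half_eq:
  assumes "p - int n \<le> c" "c < p + int n"
  shows "half n p c \<longleftrightarrow> p \<le> c"
proof (cases "p \<le> c")
  case True
  then show ?thesis using assms by (simp add: half_def)
next
  case False
  have "(c - p) mod (2 * int n) = (c - p + 2 * int n) mod (2 * int n)" by simp
  also have "\<dots> = c - p + 2 * int n" using assms False by (intro mod_pos_pos_trivial) auto
  finally show ?thesis using assms False by (simp add: half_def)
qed

lemma antiperiodic_half:
  assumes "n > 0"
  shows "antiperiodic n (half n p)"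
  unfolding antiperiodic_def
proof
  fix c
  define q where "q = (c - p) mod (2 * int n)"
  have q: "0 \<le> q" "q < 2 * int n" using assms by (simp_all add: q_def)
  have "(c + int n - p) mod (2 * int n) = (q + int n) mod (2 * int n)"
    unfolding q_def by (simp add: mod_simps algebra_simps)
  also have "\<dots> = (if q < int n then q + int n else q - int n)"
    using q by (subst mod_less_double) auto
  finally show "half n p (c + int n) = (\<not> half n p c)"
    using q by (simp add: half_def flip: q_def)
qed

text \<open>\<open>half n p\<close> switches only at integers congruent to \<open>p\<close> modulo
  \<open>n\<close>, so a window of at most \<open>n\<close> integers contains at most one
  switch.\<close>

lemma half_between:
  assumes "a \<le> b" "b \<le> c" "c < a + int n" "half n p a = half n p c"
  shows "half n p b = half n p a"
proof -
  define q where "q = (a - p) mod (2 * int n)"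
  have q: "0 \<le> q" "q < 2 * int n" using assms(1-3) by (simp_all add: q_def)
  have *: "(a + d - p) mod (2 * int n) = (if q + d < 2 * int n then q + d else q + d - 2 * int n)"
    if "0 \<le> d" "d < int n" for d
  proof -
    have "(a + d - p) mod (2 * int n) = (q + d) mod (2 * int n)"
      unfolding q_def by (simp add: mod_simps algebra_simps)
    also have "\<dots> = (if q + d < 2 * int n then q + d else q + d - 2 * int n)"
      using q that by (subst mod_less_double) auto
    finally show ?thesis .
  qed
  show ?thesis
    using assms q *[of 0] *[of "b - a"] *[of "c - a"] by (auto simp: half_def split: if_splits)
qed

lemma word_half_in_Mon:
  assumes "n > 0"
  shows "word n (half n p) \<in> Mon n"
proof -
  \<comment> \<open>In the first half of the period the word rises at \<open>q\<close>, in the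
    second half it falls at \<open>q - n\<close>.\<close>
  define q where "q = p mod (2 * int n)"
  have q: "0 \<le> q" "q < 2 * int n" using assms by (simp_all add: q_def)
  have h: "half n p = half n q"
    by (rule ext) (simp add: half_def q_def mod_simps)
  have car: "word n (half n p) \<in> {0..<n} \<rightarrow>\<^sub>E {0, 1}" by (auto simp: word_def)
  show ?thesis
  proof (cases "q \<le> int n")
    case True
    have "half n q (int i) \<longleftrightarrow> q \<le> int i" if "i < n" for i
      using True q that by (intro half_eq) auto
    then have "mono_on {0..<n} (word n (half n p))"
      by (auto simp: mono_on_def word_def h)
    then show ?thesis using car by (simp add: Mon_def)
  next
    case False
    have "half n q (int i) \<longleftrightarrow> int i < q - int n" if "i < n" for i
    proof -
      have "half n q (int i + int n) \<longleftrightarrow> q \<le> int i + int n"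
        using False q that by (intro half_eq) auto
      then show ?thesis
        using antiperiodic_add[OF antiperiodic_half[OF assms], of q "int i"] by auto
    qed
    then have "antimono_on {0..<n} (word n (half n p))"
      by (auto simp: monotone_on_def word_def h)
    then show ?thesis using car by (simp add: Mon_def)
  qed
qed

lemma Mon_eq:
  assumes "n > 0"
  shows "Mon n = range (\<lambda>p. word n (half n p))"
proof (intro equalityI subsetI)
  fix x assume x: "x \<in> Mon n"
  have bin: "x i = 0 \<or> x i = 1" if "i < n" for i
    using x that by (auto simp: Mon_def PiE_iff)
  have ext: "x i = undefined" if "\<not> i < n" for i
    using x that by (auto simp: Mon_def PiE_iff extensional_def)
  have thr: "\<exists>p\<le>n. \<forall>i<n. P i \<longleftrightarrow> p \<le> i" if P: "\<And>i j. i \<le> j \<Longrightarrow> j < n \<Longrightarrow> P i \<Longrightarrow> P j" for P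
  proof -
    \<comment> \<open>The alternative \<open>i = n\<close> supplies the threshold when
      \<open>P\<close> holds nowhere.\<close>
    define p where "p = (LEAST i. i = n \<or> P i)"
    have p: "p = n \<or> P p" unfolding p_def by (rule LeastI[of _ n]) simp
    have le: "p \<le> n" unfolding p_def by (rule Least_le) simp
    have "p \<le> i" if "P i" for i unfolding p_def by (rule Least_le) (simp add: that)
    then show ?thesis using p le P by (intro exI[of _ p]) auto
  qed
  from x have "mono_on {0..<n} x \<or> antimono_on {0..<n} x" by (simp add: Mon_def)
  then have "\<exists>p. \<forall>i<n. (x i = 1) \<longleftrightarrow> half n p (int i)"
  proof
    assume m: "mono_on {0..<n} x"
    have "x j = 1" if "i \<le> j" "j < n" "x i = 1" for i j
      using monotone_onD[OF m, of i j] that bin[of j] by auto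
    then obtain p where p: "p \<le> n" "\<forall>i<n. x i = 1 \<longleftrightarrow> p \<le> i" using thr[of "\<lambda>i. x i = 1"] by blast
    have "half n (int p) (int i) \<longleftrightarrow> p \<le> i" if "i < n" for i
      using half_eq[of "int p" n "int i"] p that by simp
    with p show ?thesis by blast
  next
    assume m: "antimono_on {0..<n} x"
    have "x j = 0" if "i \<le> j" "j < n" "x i = 0" for i j
      using monotone_onD[OF m, of i j] that bin[of j] by auto
    then obtain p where p: "p \<le> n" "\<forall>i<n. x i = 0 \<longleftrightarrow> p \<le> i" using thr[of "\<lambda>i. x i = 0"] by blast
    have "half n (int p - int n) (int i) \<longleftrightarrow> x i = 1" if "i < n" for i
    proof -
      have "half n (int p) (int i) \<longleftrightarrow> p \<le> i"
        using half_eq[of "int p" n "int i"] p that by simp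
      moreover have "half n (int p - int n) (int i) = half n (int p) (int i + int n)"
        by (simp add: half_def algebra_simps)
      ultimately show ?thesis
        using antiperiodic_add[OF antiperiodic_half[OF assms], of "int p" "int i"] p that bin[OF that]
        by auto
    qed
    then show ?thesis by blast
  qed
  then obtain p where p: "\<forall>i<n. (x i = 1) \<longleftrightarrow> half n p (int i)" by blast
  have "x i = word n (half n p) i" for i
    using p bin[of i] ext[of i] by (cases "i < n") (auto simp: word_def)
  then have "x = word n (half n p)" ..
  then show "x \<in> range (\<lambda>p. word n (half n p))" by blast
next
  fix x assume "x \<in> range (\<lambda>p. word n (half n p))"
  then show "x \<in> Mon n" using word_half_in_Mon[OF assms] by blast
qed

text \<open>This is the invariance under twisted rotations: a single switch in any window of length
  \<open>n\<close> suffices, not only in the window starting at 0.\<close>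

lemma word_in_Mon:
  assumes "n > 0" and F: "antiperiodic n F" and q: "r \<le> q" "q \<le> r + int n"
    and thr: "\<And>c. r \<le> c \<Longrightarrow> c < r + int n \<Longrightarrow> F c \<longleftrightarrow> (c < q) = \<sigma>"
  shows "word n F \<in> Mon n"
proof -
  \<comment> \<open>A half-circle that ends just before \<open>q\<close> begins at
    \<open>q - n\<close>.\<close>
  define p where "p = (if \<sigma> then q - int n else q)"
  have "F = half n p"
  proof (rule antiperiodic_eqI[OF assms(1) F antiperiodic_half[OF assms(1)]])
    fix c assume c: "r \<le> c" "c < r + int n"
    have "half n q c \<longleftrightarrow> q \<le> c" using c q by (intro half_eq) auto
    moreover have "half n (q - int n) c = half n q (c + int n)"
      by (simp add: half_def algebra_simps)
    ultimately show "F c = half n p c"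
      using thr[OF c] antiperiodic_add[OF antiperiodic_half[OF assms(1)], of q c]
      by (auto simp: p_def)
  qed
  then show ?thesis using word_half_in_Mon[OF assms(1)] by simp
qed

section \<open>Arcs of positions\<close>

lemma arc_disjoint:
  assumes "a \<le> c" "c < b" "b \<le> a + int n"
  shows "nat (c mod int n) \<notin> arc n b (a + int n)"
proof
  assume "nat (c mod int n) \<in> arc n b (a + int n)"
  then obtain d where d: "b \<le> d" "d < a + int n" "nat (c mod int n) = nat (d mod int n)"
    by (auto simp: arc_def)
  have "n > 0" using assms by linarith
  then have "0 \<le> c mod int n" "0 \<le> d mod int n" by auto
  then have "d mod int n = c mod int n" using d(3) by linarith
  then have "int n dvd d - c" by (rule mod_eq_dvd_iff[THEN iffD1])
  moreover have "0 < d - c" "d - c < int n" using assms d by auto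
  ultimately show False using zdvd_imp_le by fastforce
qed

lemma arc_subset: "n > 0 \<Longrightarrow> arc n a b \<subseteq> {0..<n}"
  by (auto simp: arc_def nat_less_iff)

lemma arc_shift: "arc n (a + int n) (b + int n) = arc n a b"
proof -
  have "arc n (a + int n) (b + int n) \<subseteq> arc n a b" for a b
  proof
    fix i assume "i \<in> arc n (a + int n) (b + int n)"
    then obtain c where c: "a + int n \<le> c" "c < b + int n" "i = nat (c mod int n)"
      by (auto simp: arc_def)
    then have "i = nat ((c - int n) mod int n)" by simp
    with c show "i \<in> arc n a b" unfolding arc_def by (intro CollectI exI[of _ "c - int n"]) auto
  qed
  moreover have "arc n a b \<subseteq> arc n (a + int n) (b + int n)"
  proof
    fix i assume "i \<in> arc n a b"
    then obtain c where c: "a \<le> c" "c < b" "i = nat (c mod int n)" by (auto simp: arc_def)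
    then have "i = nat ((c + int n) mod int n)" by simp
    with c show "i \<in> arc n (a + int n) (b + int n)"
      unfolding arc_def by (intro CollectI exI[of _ "c + int n"]) auto
  qed
  ultimately show ?thesis by blast
qed

section \<open>Minimality: no facet can be removed\<close>

lemma PiE_if:
  assumes "x \<in> J \<rightarrow>\<^sub>E B" "y \<in> J \<rightarrow>\<^sub>E B"
  shows "(\<lambda>j. if P j then x j else y j) \<in> J \<rightarrow>\<^sub>E B"
  using assms by (auto simp: PiE_iff extensional_def)

text \<open>Only the facet opposite \<open>A\<^sub>0\<close> is treated; the others follow by
  rotation. The other three blocks have at least two positions, so that a word can switch inside
  each of them.\<close>

lemma facet_needed:
  fixes n :: nat and a0 a1 a2 a3 :: int
  assumes a: "a0 < a1" "a1 + 2 \<le> a2" "a2 + 2 \<le> a3" "a3 + 2 \<le> a0 + int n"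
    and K: "K \<subseteq> complex_of {arc n a1 (a0 + int n), arc n a2 (a1 + int n),
                          arc n a3 (a2 + int n), arc n a0 a3}"
    and notin: "arc n a1 (a0 + int n) \<notin> K"
  shows "\<not> generates {0..<n} {0, 1} K (Mon n)"
proof
  assume "generates {0..<n} {0, 1} K (Mon n)"
  then obtain B J :: "nat set" and f where fin: "finite J"
    and img: "f ` (J \<rightarrow>\<^sub>E B) = Mon n"
    and cc: "communication_complex {0..<n} B J f \<subseteq> K"
    unfolding generates_def by blast
  have n: "n > 0" using a by linarith
  define pos where "pos c = nat (c mod int n)" for c
  have pos: "pos c < n" for c using n by (simp add: pos_def nat_less_iff)
  \<comment> \<open>The positions that read \<open>j\<close>; for \<open>j\<close> in
    \<open>J\<close> they form a simplex of the communication complex.\<close>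
  define R where "R j = {i\<in>{0..<n}. j \<in> input_window B J f i}" for j
  define avoids where "avoids j u v \<longleftrightarrow> (\<forall>c. u \<le> c \<longrightarrow> c < v \<longrightarrow> pos c \<notin> R j)" for j u v
  \<comment> \<open>\<open>R j\<close> lies in a facet and so misses a block. If this is the facet
    opposite \<open>A\<^sub>0\<close>, which is not in \<open>K\<close>, then \<open>R j\<close> is
    not all of it and also misses some \<open>m\<close>.\<close>
  have types: "avoids j a1 a2 \<or> avoids j a2 a3 \<or> avoids j a3 (a0 + int n) \<or>
     (avoids j a0 a1 \<and> (\<exists>m. a1 \<le> m \<and> m < a0 + int n \<and> pos m \<notin> R j))" if j: "j \<in> J" for j
  proof -
    have "R j \<in> communication_complex {0..<n} B J f"
      using j by (auto simp: communication_complex_def R_def)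
    then have RK: "R j \<in> K" using cc by blast
    have "R j \<in> complex_of {arc n a1 (a0 + int n), arc n a2 (a1 + int n),
        arc n a3 (a2 + int n), arc n a0 a3}" by (rule subsetD[OF K RK])
    then obtain T where T: "T \<in> {arc n a1 (a0 + int n), arc n a2 (a1 + int n),
        arc n a3 (a2 + int n), arc n a0 a3}" "R j \<subseteq> T"
      unfolding complex_of_def by blast
    have av: "avoids j u v" if "R j \<subseteq> arc n v (u + int n)" "v \<le> u + int n" for u v
      using arc_disjoint[of u _ v n] that unfolding avoids_def pos_def by blast
    from T(1) consider "T = arc n a1 (a0 + int n)" | "T = arc n a2 (a1 + int n)"
      | "T = arc n a3 (a2 + int n)" | "T = arc n a0 a3" by blast
    then show ?thesis
    proof cases
      case 1
      have "\<exists>m. a1 \<le> m \<and> m < a0 + int n \<and> pos m \<notin> R j"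
      proof (rule ccontr)
        assume "\<not> ?thesis"
        then have "arc n a1 (a0 + int n) \<subseteq> R j" by (auto simp: arc_def pos_def)
        then have "R j = arc n a1 (a0 + int n)" using T(2) 1 by blast
        then show False using RK notin by simp
      qed
      moreover have "avoids j a0 a1" using av[of a1 a0] T(2) 1 a by auto
      ultimately show ?thesis by blast
    next
      case 2 then show ?thesis using av[of a2 a1] T(2) a by auto
    next
      case 3 then show ?thesis using av[of a3 a2] T(2) a by auto
    next
      case 4
      then have "T = arc n (a0 + int n) (a3 + int n)" by (simp add: arc_shift)
      then show ?thesis using av[of "a0 + int n" a3] T(2) a by auto
    qed
  qed
  define J1 where "J1 = {j. avoids j a1 a2}"
  define J2 where "J2 = {j. avoids j a2 a3}"
  define J3 where "J3 = {j. avoids j a3 (a0 + int n)}"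
  have J0: "avoids j a0 a1" if "j \<in> J" "j \<notin> J1 \<union> J2 \<union> J3" for j
    using types[OF that(1)] that(2) by (auto simp: J1_def J2_def J3_def)
  have "\<forall>j \<in> J - (J1 \<union> J2 \<union> J3). \<exists>m. a1 \<le> m \<and> m < a0 + int n \<and> pos m \<notin> R j"
    using types by (auto simp: J1_def J2_def J3_def)
  \<comment> \<open>One missed position is fixed for each input outside \<open>J1\<close>,
    \<open>J2\<close>, \<open>J3\<close>; it decides when the input is exchanged in the sweep
    below.\<close>
  then obtain \<mu> where \<mu>: "\<And>j. j \<in> J \<Longrightarrow> j \<notin> J1 \<union> J2 \<union> J3 \<Longrightarrow>
      a1 \<le> \<mu> j \<and> \<mu> j < a0 + int n \<and> pos (\<mu> j) \<notin> R j"
    by (metis DiffI)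

  let ?X = "J \<rightarrow>\<^sub>E B"
  define E where "E x = lift n (f x)" for x
  have anti: "antiperiodic n (E x)" for x unfolding E_def by (rule antiperiodic_lift[OF n])
  have E_half: "\<exists>p. E x = half n p" if x: "x \<in> ?X" for x
  proof -
    have "f x \<in> Mon n" using img x by blast
    then obtain p where "f x = word n (half n p)" unfolding Mon_eq[OF n] by blast
    then show ?thesis unfolding E_def using lift_word[OF n antiperiodic_half[OF n]] by metis
  qed
  have between: "E x b = E x u" if "x \<in> ?X" "u \<le> b" "b \<le> v" "v < u + int n" "E x u = E x v"
    for x u b v
    using E_half[OF that(1)] half_between[of u b v n] that by metis
  have surj: "\<exists>x\<in>?X. E x = half n p" for p
  proof -
    have "word n (half n p) \<in> f ` ?X" unfolding img by (rule word_half_in_Mon[OF n])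
    then show ?thesis unfolding E_def using lift_word[OF n antiperiodic_half[OF n]] by (metis imageE)
  qed
  have local: "E x c = E y c"
    if "x \<in> ?X" "y \<in> ?X" "\<And>j. j \<in> J \<Longrightarrow> pos c \<in> R j \<Longrightarrow> x j = y j" for x y c
  proof -
    have "x j = y j" if j: "j \<in> input_window B J f (pos c)" for j
    proof (rule \<open>\<And>j. j \<in> J \<Longrightarrow> pos c \<in> R j \<Longrightarrow> x j = y j\<close>)
      show "j \<in> J" using input_window_least(1)[OF fin] j by (rule subsetD)
      show "pos c \<in> R j" using pos j by (simp add: R_def)
    qed
    then have "f x (pos c) = f y (pos c)"
      using input_window_least(2)[OF fin, of B f "pos c"] that(1,2) unfolding determines_def by blast
    then show ?thesis by (simp add: E_def lift_def pos_def)
  qed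

  \<comment> \<open>The words of \<open>w\<close> and \<open>s\<close> fall right after
    \<open>a1\<close> and \<open>a3\<close>; that of \<open>v\<close> rises right after
    \<open>a2\<close>.\<close>
  obtain w where w: "w \<in> ?X" "E w = half n (a1 + 1 - int n)" using surj by blast
  have wE: "E w a1" "\<not> E w (a1 + 1)"
    using half_eq[of "a1 + 1 - int n" n a1] half_eq[of "a1 + 1 - int n" n "a1 + 1 - int n"]
      antiperiodic_diff[OF anti[of w], of "a1 + 1"] n
    by (auto simp: w(2))
  obtain s where s: "s \<in> ?X" "E s = half n (a3 + 1 - int n)" using surj by blast
  have sE: "E s a3" "\<not> E s (a3 + 1)"
    using half_eq[of "a3 + 1 - int n" n a3] half_eq[of "a3 + 1 - int n" n "a3 + 1 - int n"]
      antiperiodic_diff[OF anti[of s], of "a3 + 1"] n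
    by (auto simp: s(2))
  obtain v where v: "v \<in> ?X" "E v = half n (a2 + 1)" using surj by blast
  have vE: "\<not> E v a2" "E v (a2 + 1)"
    using half_eq[of "a2 + 1" n a2] half_eq[of "a2 + 1" n "a2 + 1"] n by (auto simp: v(2))

  \<comment> \<open>In \<open>G t z\<close>, the choice of \<open>t\<close> is invisible on
    \<open>A\<^sub>2\<close> and that of \<open>z\<close> is invisible on
    \<open>A\<^sub>0\<close>.\<close>
  define G where
    "G t z = (\<lambda>j. if j \<in> J1 \<union> J3 then v j else if j \<in> J2 then t j else z j)" for t z
  have GX: "G t z \<in> ?X" if "t \<in> ?X" "z \<in> ?X" for t z
    unfolding G_def by (intro PiE_if that v(1))
  \<comment> \<open>With \<open>z = v\<close>, the word agrees with that of \<open>v\<close> on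
    \<open>A\<^sub>2\<close>. Its rise there forces 0 on the \<open>n\<close> integers up to
    \<open>a2\<close>, and replacing \<open>v\<close> by \<open>z\<close> is not seen at
    \<open>a1 - 1\<close>.\<close>
  have G0: "\<not> E (G t z) (a1 - 1)" if t: "t \<in> ?X" and z: "z \<in> ?X" for t z
  proof -
    let ?y = "G t v"
    have y: "?y \<in> ?X" by (rule GX[OF t v(1)])
    have eq: "E ?y c = E v c" if "a2 \<le> c" "c < a3" for c
      by (rule local[OF y v(1)]) (use that in \<open>auto simp: G_def J2_def avoids_def\<close>)
    have "\<not> E ?y a2" "E ?y (a2 + 1)" using eq[of a2] eq[of "a2 + 1"] vE a by auto
    moreover from this have "\<not> E ?y (a2 + 1 - int n)"
      using antiperiodic_diff[OF anti[of ?y], of "a2 + 1"] by simp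
    ultimately have "\<not> E ?y (a1 - 1)"
      using between[OF y, of "a2 + 1 - int n" "a1 - 1" a2] a by auto
    moreover have "E (G t z) (a1 - 1) = E ?y (a1 - 1)"
    proof (rule local[OF GX[OF t z] y])
      fix j assume j: "j \<in> J" "pos (a1 - 1) \<in> R j"
      then have "\<not> avoids j a0 a1" using a unfolding avoids_def by (intro notI) auto
      then show "G t z j = G t v j" using J0[OF j(1)] by (auto simp: G_def)
    qed
    ultimately show ?thesis by simp
  qed
  \<comment> \<open>Starting from 0 at \<open>a1 - 1\<close>, the word can switch only once before
    \<open>a0 + n\<close>.\<close>
  have up: "E (G t z) d" if "E (G t z) c" "a1 \<le> c" "c \<le> d" "d < a0 + int n" "t \<in> ?X" "z \<in> ?X"
    for t z c d
    using G0[of t z] between[OF GX[of t z], of "a1 - 1" c d] that a by auto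
  \<comment> \<open>Keeping \<open>w\<close> outside \<open>J1\<close> preserves the fall in
    \<open>A\<^sub>1\<close>, after which the word is 0 up to \<open>a1 + n\<close>. The last
    position of \<open>A\<^sub>3\<close> does not see the change on \<open>J3\<close>.\<close>
  have Gw: "\<not> E (G w w) (a0 + int n - 1)"
  proof -
    define y where "y = (\<lambda>j. if j \<in> J1 then v j else w j)"
    have y: "y \<in> ?X" unfolding y_def by (intro PiE_if v(1) w(1))
    have eq: "E y c = E w c" if "a1 \<le> c" "c < a2" for c
      by (rule local[OF y w(1)]) (use that in \<open>auto simp: y_def J1_def avoids_def\<close>)
    have "E y a1" "\<not> E y (a1 + 1)" using eq[of a1] eq[of "a1 + 1"] wE a by auto
    moreover from this have "\<not> E y (a1 + int n)"
      using antiperiodic_add[OF anti[of y], of "a1"] by simp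
    ultimately have "\<not> E y (a0 + int n - 1)"
      using between[OF y, of "a1 + 1" "a0 + int n - 1" "a1 + int n"] a by auto
    moreover have "E (G w w) (a0 + int n - 1) = E y (a0 + int n - 1)"
      by (rule local[OF GX[OF w(1) w(1)] y])
        (use a in \<open>auto simp: G_def y_def J3_def avoids_def\<close>)
    ultimately show ?thesis by simp
  qed
  \<comment> \<open>Symmetrically, the fall in \<open>A\<^sub>3\<close> forces 1 on the
    \<open>n\<close> integers up to \<open>a3\<close>, and \<open>a1\<close> does not see the change
    on \<open>J1\<close>.\<close>
  have Gs: "E (G s s) a1"
  proof -
    define y where "y = (\<lambda>j. if j \<in> J3 then v j else s j)"
    have y: "y \<in> ?X" unfolding y_def by (intro PiE_if v(1) s(1))
    have eq: "E y c = E s c" if "a3 \<le> c" "c < a0 + int n" for c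
      by (rule local[OF y s(1)]) (use that in \<open>auto simp: y_def J3_def avoids_def\<close>)
    have "E y a3" "\<not> E y (a3 + 1)" using eq[of a3] eq[of "a3 + 1"] sE a by auto
    moreover from this have "E y (a3 + 1 - int n)"
      using antiperiodic_diff[OF anti[of y], of "a3 + 1"] by simp
    ultimately have "E y a1"
      using between[OF y, of "a3 + 1 - int n" a1 a3] a by auto
    moreover have "E (G s s) a1 = E y a1"
      by (rule local[OF GX[OF s(1) s(1)] y])
        (use a in \<open>auto simp: G_def y_def J1_def avoids_def\<close>)
    ultimately show ?thesis by simp
  qed

  define Z where "Z k = (\<lambda>j. if \<mu> j < k then w j else s j)" for k
  have ZX: "Z k \<in> ?X" for k unfolding Z_def by (intro PiE_if w(1) s(1))
  \<comment> \<open>Only inputs with \<open>\<mu> j = k\<close> are exchanged, and outside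
    \<open>J1\<close>, \<open>J2\<close>, \<open>J3\<close> position \<open>k\<close> does not read
    them.\<close>
  have Z_step: "E (G t (Z (k + 1))) k = E (G t (Z k)) k"
    if t: "t \<in> ?X" for t k
  proof (rule local[OF GX[OF t ZX] GX[OF t ZX]])
    fix j assume j: "j \<in> J" "pos k \<in> R j"
    then have "\<mu> j \<noteq> k" if "j \<notin> J1 \<union> J2 \<union> J3" using \<mu>[OF j(1) that] by auto
    then show "G t (Z (k + 1)) j = G t (Z k) j" by (auto simp: G_def Z_def)
  qed
  \<comment> \<open>The exchange at \<open>k\<close> keeps the 1 there, and \<open>up\<close>
    carries it to \<open>k + 1\<close>. At \<open>k = a1\<close> nothing has been exchanged yet, as
    \<open>\<mu> j \<ge> a1\<close>.\<close>
  have low: "E (G s (Z k)) k" if "a1 \<le> k" "k \<le> a2" for k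
    using that
  proof (induction k rule: int_ge_induct)
    case base
    have "E (G s (Z a1)) a1 = E (G s s) a1"
    proof (rule local[OF GX[OF s(1) ZX] GX[OF s(1) s(1)]])
      fix j assume "j \<in> J"
      then show "G s (Z a1) j = G s s j" using \<mu>[of j] by (auto simp: G_def Z_def)
    qed
    then show ?case using Gs by simp
  next
    case (step k)
    then have "E (G s (Z (k + 1))) k" using Z_step[OF s(1)] by simp
    then show ?case by (rule up) (use step a s(1) ZX in auto)
  qed
  \<comment> \<open>Downwards, undoing the exchange at \<open>k\<close> keeps the 0 there, and
    \<open>up\<close> read backwards gives 0 at \<open>k - 1\<close>. At the start every relevant
    input comes from \<open>w\<close>.\<close>
  have high: "\<not> E (G w (Z (k + 1))) k" if "k \<le> a0 + int n - 1" "a2 \<le> k" for k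
    using that
  proof (induction k rule: int_le_induct)
    case base
    have "E (G w (Z (a0 + int n - 1 + 1))) (a0 + int n - 1) = E (G w w) (a0 + int n - 1)"
    proof (rule local[OF GX[OF w(1) ZX] GX[OF w(1) w(1)]])
      fix j assume "j \<in> J"
      then show "G w (Z (a0 + int n - 1 + 1)) j = G w w j" using \<mu>[of j] by (auto simp: G_def Z_def)
    qed
    then show ?case using Gw by simp
  next
    case (step k)
    then have "\<not> E (G w (Z k)) k" using Z_step[OF w(1)] by simp
    then have "\<not> E (G w (Z k)) (k - 1)"
      using up[of w "Z k" "k - 1" k] step a w(1) ZX by auto
    then show ?case by simp
  qed
  have "E (G s (Z a2)) a2" using low[of a2] a by simp
  moreover have "\<not> E (G w (Z a2)) a2" using high[of a2] Z_step[OF w(1), of a2] a by simp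
  \<comment> \<open>The two mixtures differ only on inputs in \<open>J2\<close>, which
    \<open>a2\<close> does not read.\<close>
  moreover have "E (G s (Z a2)) a2 = E (G w (Z a2)) a2"
    by (rule local[OF GX[OF s(1) ZX] GX[OF w(1) ZX]])
      (use a in \<open>auto simp: G_def J2_def avoids_def\<close>)
  ultimately show False by simp
qed

section \<open>Generation: weighted signs and block letters\<close>

text \<open>The weights are chosen so that two equal nonzero outer signs beat the middle one, the middle one
  beats a single outer one, and a tie forces the middle sign to be 0.\<close>

definition letter :: "int \<Rightarrow> int \<Rightarrow> int \<Rightarrow> int \<Rightarrow> bool" where
  "letter a b c d =
     (let u = 2 * (sgn a + sgn c) + 3 * sgn b
      in if u \<noteq> 0 then u > 0 else if a = 0 then True else (d < \<bar>a\<bar>) = (a > 0))"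

definition is_const :: "bool \<Rightarrow> (int \<Rightarrow> bool) \<Rightarrow> bool" where
  "is_const \<sigma> g \<longleftrightarrow> (\<forall>d. g d = \<sigma>)"

definition is_step :: "bool \<Rightarrow> (int \<Rightarrow> bool) \<Rightarrow> bool" where
  "is_step \<sigma> g \<longleftrightarrow> (\<exists>t\<ge>0. \<forall>d. g d = ((d < t) = \<sigma>))"

lemma is_const_letter:
  "2 * (sgn a + sgn c) + 3 * sgn b > 0 \<Longrightarrow> is_const \<sigma> (letter a b c) \<longleftrightarrow> \<sigma>"
  "2 * (sgn a + sgn c) + 3 * sgn b < 0 \<Longrightarrow> is_const \<sigma> (letter a b c) \<longleftrightarrow> \<not> \<sigma>"
  "is_const \<sigma> (letter 0 0 0) \<longleftrightarrow> \<sigma>"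
  by (auto simp: is_const_def letter_def)

lemma is_step_letter:
  assumes "sgn c = - sgn a" "a \<noteq> 0"
  shows "is_step (a > 0) (letter a 0 c)"
  unfolding is_step_def by (rule exI[of _ "\<bar>a\<bar>"]) (use assms in \<open>auto simp: letter_def\<close>)

text \<open>Signs alone decide which letters are constant or steps, so 81 sign patterns remain. In
  each, the four blocks in order admit at most one switch, from \<open>\<sigma>\<close> to its
  negation.\<close>

lemma letter_pattern:
  fixes p q r s :: int
  defines "g0 \<equiv> letter q r s" and "g1 \<equiv> letter r s (- p)"
    and "g2 \<equiv> letter s (- p) (- q)" and "g3 \<equiv> letter (- p) (- q) (- r)"
  shows "\<exists>\<sigma>.
    (is_const \<sigma> g0 \<or> is_step \<sigma> g0) \<and> is_const (\<not> \<sigma>) g1 \<and> is_const (\<not> \<sigma>) g2 \<and> is_const (\<not> \<sigma>) g3 \<or>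
    is_const \<sigma> g0 \<and> (is_const \<sigma> g1 \<or> is_step \<sigma> g1) \<and> is_const (\<not> \<sigma>) g2 \<and> is_const (\<not> \<sigma>) g3 \<or>
    is_const \<sigma> g0 \<and> is_const \<sigma> g1 \<and> (is_const \<sigma> g2 \<or> is_step \<sigma> g2) \<and> is_const (\<not> \<sigma>) g3 \<or>
    is_const \<sigma> g0 \<and> is_const \<sigma> g1 \<and> is_const \<sigma> g2 \<and> (is_const \<sigma> g3 \<or> is_step \<sigma> g3)"
  unfolding assms ex_bool_eq
  by (cases p "0 :: int" rule: linorder_cases; cases q "0 :: int" rule: linorder_cases;
      cases r "0 :: int" rule: linorder_cases; cases s "0 :: int" rule: linorder_cases;
      use is_step_letter[of s q] is_step_letter[of "- p" r] is_step_letter[of "- q" s]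
        is_step_letter[of "- r" "- p"] in \<open>simp add: is_const_letter\<close>)

text \<open>Block \<open>k\<close> reads \<open>x (k + 1)\<close>, \<open>x (k + 2)\<close>, \<open>x (k + 3)\<close> in the convention \<open>x (k + 4) = - x k\<close>,
  which matches the antiperiodicity of the words.\<close>

definition block_letter :: "int \<Rightarrow> int \<Rightarrow> int \<Rightarrow> int \<Rightarrow> (nat \<Rightarrow> int) \<Rightarrow> int \<Rightarrow> bool" where
  "block_letter a0 a1 a2 a3 x c =
     (if c < a1 then letter (x 1) (x 2) (x 3) (c - a0)
      else if c < a2 then letter (x 2) (x 3) (- x 0) (c - a1)
      else if c < a3 then letter (x 3) (- x 0) (- x 1) (c - a2)
      else letter (- x 0) (- x 1) (- x 2) (c - a3))"

definition block :: "int \<Rightarrow> int \<Rightarrow> int \<Rightarrow> int \<Rightarrow> nat" where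
  "block a1 a2 a3 c = (if c < a1 then 0 else if c < a2 then 1 else if c < a3 then 2 else 3)"

definition antiperiodic_ext :: "nat \<Rightarrow> int \<Rightarrow> (int \<Rightarrow> bool) \<Rightarrow> int \<Rightarrow> bool" where
  "antiperiodic_ext n r g c \<longleftrightarrow> g (r + (c - r) mod int n) = even ((c - r) div int n)"

lemma antiperiodic_ext:
  assumes "n > 0"
  shows "antiperiodic n (antiperiodic_ext n r g)"
proof -
  have "(c + int n - r) mod int n = (c - r) mod int n"
    "(c + int n - r) div int n = (c - r) div int n + 1" for c
    using assms mod_add_self2[of "c - r" "int n"] div_add_self2[of "int n" "c - r"]
    by (simp_all add: algebra_simps)
  then show ?thesis by (simp add: antiperiodic_def antiperiodic_ext_def)
qed

lemma antiperiodic_ext_eq: "r \<le> c \<Longrightarrow> c < r + int n \<Longrightarrow> antiperiodic_ext n r g c = g c"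
  by (simp add: antiperiodic_ext_def)

lemma block_letter_threshold:
  assumes a: "a0 \<le> a1" "a1 \<le> a2" "a2 \<le> a3" "a3 \<le> e"
  shows "\<exists>q \<sigma>. a0 \<le> q \<and> q \<le> e \<and>
    (\<forall>c. a0 \<le> c \<longrightarrow> c < e \<longrightarrow> block_letter a0 a1 a2 a3 x c = ((c < q) = \<sigma>))"
proof -
  define g0 where "g0 = letter (x 1) (x 2) (x 3)"
  define g1 where "g1 = letter (x 2) (x 3) (- x 0)"
  define g2 where "g2 = letter (x 3) (- x 0) (- x 1)"
  define g3 where "g3 = letter (- x 0) (- x 1) (- x 2)"
  have H: "block_letter a0 a1 a2 a3 x c =
     (if c < a1 then g0 (c - a0) else if c < a2 then g1 (c - a1)
      else if c < a3 then g2 (c - a2) else g3 (c - a3))" for c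
    by (simp add: block_letter_def g0_def g1_def g2_def g3_def)
  have step: "\<exists>q. u \<le> q \<and> q \<le> v \<and> (\<forall>c. u \<le> c \<longrightarrow> c < v \<longrightarrow> g (c - u) = ((c < q) = \<sigma>))"
    if "u \<le> v" "is_const \<sigma> g \<or> is_step \<sigma> g" for u v \<sigma> g
    using that(2)
  proof
    assume "is_const \<sigma> g"
    then show ?thesis using that(1) by (intro exI[of _ v]) (simp add: is_const_def)
  next
    assume "is_step \<sigma> g"
    then obtain t where t: "t \<ge> 0" "\<And>d. g d = ((d < t) = \<sigma>)"
      unfolding is_step_def by blast
    \<comment> \<open>The step may occur beyond the end of the block; the threshold is then cut off
      at \<open>v\<close>.\<close>
    have "c - u < t \<longleftrightarrow> c < min v (u + t)" if "c < v" for c using that by auto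
    then have "\<forall>c. u \<le> c \<longrightarrow> c < v \<longrightarrow> g (c - u) = ((c < min v (u + t)) = \<sigma>)"
      by (simp only: t(2)) blast
    then show ?thesis using that(1) t(1) by (intro exI[of _ "min v (u + t)"]) simp
  qed
  obtain \<sigma> where "
    (is_const \<sigma> g0 \<or> is_step \<sigma> g0) \<and> is_const (\<not> \<sigma>) g1 \<and> is_const (\<not> \<sigma>) g2 \<and> is_const (\<not> \<sigma>) g3 \<or>
    is_const \<sigma> g0 \<and> (is_const \<sigma> g1 \<or> is_step \<sigma> g1) \<and> is_const (\<not> \<sigma>) g2 \<and> is_const (\<not> \<sigma>) g3 \<or>
    is_const \<sigma> g0 \<and> is_const \<sigma> g1 \<and> (is_const \<sigma> g2 \<or> is_step \<sigma> g2) \<and> is_const (\<not> \<sigma>) g3 \<or>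
    is_const \<sigma> g0 \<and> is_const \<sigma> g1 \<and> is_const \<sigma> g2 \<and> (is_const \<sigma> g3 \<or> is_step \<sigma> g3)"
    using letter_pattern[of "x 1" "x 2" "x 3" "x 0"]
    unfolding g0_def g1_def g2_def g3_def by (rule exE)
  then consider
    "is_const (\<not> \<sigma>) g1" "is_const (\<not> \<sigma>) g2" "is_const (\<not> \<sigma>) g3" "is_const \<sigma> g0 \<or> is_step \<sigma> g0"
  | "is_const \<sigma> g0" "is_const (\<not> \<sigma>) g2" "is_const (\<not> \<sigma>) g3" "is_const \<sigma> g1 \<or> is_step \<sigma> g1"
  | "is_const \<sigma> g0" "is_const \<sigma> g1" "is_const (\<not> \<sigma>) g3" "is_const \<sigma> g2 \<or> is_step \<sigma> g2"
  | "is_const \<sigma> g0" "is_const \<sigma> g1" "is_const \<sigma> g2" "is_const \<sigma> g3 \<or> is_step \<sigma> g3"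
    by blast
  then show ?thesis
  proof cases
    case g: 1
    then obtain q where "a0 \<le> q" "q \<le> a1"
      "\<forall>c. a0 \<le> c \<longrightarrow> c < a1 \<longrightarrow> g0 (c - a0) = ((c < q) = \<sigma>)"
      using step[of a0 a1 \<sigma> g0] a by blast
    then show ?thesis
      using g a by (intro exI[of _ q] exI[of _ \<sigma>]) (simp add: H is_const_def)
  next
    case g: 2
    then obtain q where "a1 \<le> q" "q \<le> a2"
      "\<forall>c. a1 \<le> c \<longrightarrow> c < a2 \<longrightarrow> g1 (c - a1) = ((c < q) = \<sigma>)"
      using step[of a1 a2 \<sigma> g1] a by blast
    then show ?thesis
      using g a by (intro exI[of _ q] exI[of _ \<sigma>]) (simp add: H is_const_def)
  next
    case g: 3
    then obtain q where "a2 \<le> q" "q \<le> a3"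
      "\<forall>c. a2 \<le> c \<longrightarrow> c < a3 \<longrightarrow> g2 (c - a2) = ((c < q) = \<sigma>)"
      using step[of a2 a3 \<sigma> g2] a by blast
    then show ?thesis
      using g a by (intro exI[of _ q] exI[of _ \<sigma>]) (simp add: H is_const_def)
  next
    case g: 4
    then obtain q where "a3 \<le> q" "q \<le> e"
      "\<forall>c. a3 \<le> c \<longrightarrow> c < e \<longrightarrow> g3 (c - a3) = ((c < q) = \<sigma>)"
      using step[of a3 e \<sigma> g3] a by blast
    then show ?thesis
      using g a by (intro exI[of _ q] exI[of _ \<sigma>]) (simp add: H is_const_def)
  qed
qed

text \<open>To switch inside block \<open>k\<close>, its two outer inputs get opposite signs, making
  a tie, and the other two inputs are 0. The first outer input has absolute value
  \<open>q - a\<^sub>k\<close>, nonzero because \<open>q > a\<^sub>k\<close>. Constant words arise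
  from \<open>q = a0 + N\<close>.\<close>

lemma block_letter_surj:
  assumes a: "a0 \<le> a1" "a1 \<le> a2" "a2 \<le> a3" "a3 \<le> a0 + N" and q: "a0 < q" "q \<le> a0 + N"
  shows "\<exists>x \<in> {0..<4} \<rightarrow>\<^sub>E {- N..N}.
    \<forall>c. a0 \<le> c \<longrightarrow> c < a0 + N \<longrightarrow> block_letter a0 a1 a2 a3 x c = ((c < q) = \<sigma>)"
proof -
  define \<epsilon> :: int where "\<epsilon> = (if \<sigma> then 1 else -1)"
  define cfg where "cfg p q r s = (\<lambda>j\<in>{0..<4::nat}. if j = 0 then p else if j = 1 then q
      else if j = 2 then r else s)" for p q r s :: int
  have cfg: "cfg p q r s 0 = p" "cfg p q r s 1 = q" "cfg p q r s (Suc 0) = q"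
      "cfg p q r s 2 = r" "cfg p q r s 3 = s" for p q r s
    by (simp_all add: cfg_def)
  have mem: "cfg p q r s \<in> {0..<4} \<rightarrow>\<^sub>E {- N..N}"
    if "\<bar>p\<bar> \<le> N" "\<bar>q\<bar> \<le> N" "\<bar>r\<bar> \<le> N" "\<bar>s\<bar> \<le> N" for p q r s
    using that by (auto simp: cfg_def)
  consider "q \<le> a1" | "a1 < q" "q \<le> a2" | "a2 < q" "q \<le> a3" | "a3 < q" by linarith
  then show ?thesis
  proof cases
    case 1
    show ?thesis
      by (rule bexI[OF _ mem[of 0 "\<epsilon> * (q - a0)" 0 "- \<epsilon>"]])
        (use 1 a q in \<open>auto simp: block_letter_def cfg letter_def \<epsilon>_def sgn_mult\<close>)
  next
    case 2
    show ?thesis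
      by (rule bexI[OF _ mem[of \<epsilon> 0 "\<epsilon> * (q - a1)" 0]])
        (use 2 a q in \<open>auto simp: block_letter_def cfg letter_def \<epsilon>_def sgn_mult\<close>)
  next
    case 3
    show ?thesis
      by (rule bexI[OF _ mem[of 0 \<epsilon> 0 "\<epsilon> * (q - a2)"]])
        (use 3 a q in \<open>auto simp: block_letter_def cfg letter_def \<epsilon>_def sgn_mult\<close>)
  next
    case 4
    show ?thesis
      by (rule bexI[OF _ mem[of "- \<epsilon> * (q - a3)" 0 \<epsilon> 0]])
        (use 4 a q in \<open>auto simp: block_letter_def cfg letter_def \<epsilon>_def sgn_mult\<close>)
  qed
qed

lemma block_letter_local:
  assumes "\<forall>j \<in> {0..<4} - {block a1 a2 a3 c}. x j = y j"
  shows "block_letter a0 a1 a2 a3 x c = block_letter a0 a1 a2 a3 y c"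
  using assms by (auto simp: block_def block_letter_def split: if_splits)

lemma generates_four_arcs:
  fixes n :: nat and a0 a1 a2 a3 :: int
  assumes n: "n > 0" and a: "a0 \<le> a1" "a1 \<le> a2" "a2 \<le> a3" "a3 \<le> a0 + int n"
  shows "generates {0..<n} {0, 1} (complex_of {arc n a1 (a0 + int n), arc n a2 (a1 + int n),
                          arc n a3 (a2 + int n), arc n a0 a3}) (Mon n)"
proof -
  define J :: "nat set" where "J = {0..<4}"
  define B where "B = {- int n..int n}"
  define F where "F x = antiperiodic_ext n a0 (block_letter a0 a1 a2 a3 x)" for x
  define f where "f x = word n (F x)" for x
  \<comment> \<open>The representative of position \<open>i\<close> in the window of the four
    blocks.\<close>
  define base where "base i = a0 + (int i - a0) mod int n" for i
  have base: "a0 \<le> base i" "base i < a0 + int n" for i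
    using n by (simp_all add: base_def)
  have anti: "antiperiodic n (F x)" for x
    unfolding F_def by (rule antiperiodic_ext[OF n])
  have F_eq: "F x c = block_letter a0 a1 a2 a3 x c" if "a0 \<le> c" "c < a0 + int n" for x c
    unfolding F_def using that by (rule antiperiodic_ext_eq)
  have in_Mon: "f x \<in> Mon n" for x
  proof -
    obtain q \<sigma> where q: "a0 \<le> q" "q \<le> a0 + int n"
      "\<forall>c. a0 \<le> c \<longrightarrow> c < a0 + int n \<longrightarrow> block_letter a0 a1 a2 a3 x c = ((c < q) = \<sigma>)"
      using block_letter_threshold[OF a] by blast
    show ?thesis unfolding f_def
    proof (rule word_in_Mon[OF n anti q(1,2)])
      show "F x c = ((c < q) = \<sigma>)" if "a0 \<le> c" "c < a0 + int n" for c
        using q(3) that F_eq[OF that] by simp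
    qed
  qed
  have surj: "\<exists>x \<in> J \<rightarrow>\<^sub>E B. F x = half n p" for p
  proof -
    \<comment> \<open>The offset by 1 puts \<open>q\<close> in the range from \<open>a0 + 1\<close>
      to \<open>a0 + n\<close> required by \<open>block_letter_surj\<close>; each of the
      \<open>k\<close> turns complements the word.\<close>
    define k where "k = (p - a0 - 1) div int n"
    define q where "q = a0 + 1 + (p - a0 - 1) mod int n"
    have p: "p = q + k * int n" by (simp add: k_def q_def)
    have q: "a0 < q" "q \<le> a0 + int n"
      using n pos_mod_bound[of "int n" "p - a0 - 1"] pos_mod_sign[of "int n" "p - a0 - 1"]
      unfolding q_def by linarith+
    obtain x where x: "x \<in> J \<rightarrow>\<^sub>E B"
      "\<forall>c. a0 \<le> c \<longrightarrow> c < a0 + int n \<longrightarrow> block_letter a0 a1 a2 a3 x c = ((c < q) = odd k)"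
      using block_letter_surj[OF a q, of "odd k"] unfolding J_def B_def by blast
    have "F x = half n p"
    proof (rule antiperiodic_eqI[OF n anti antiperiodic_half[OF n]])
      fix c assume c: "a0 \<le> c" "c < a0 + int n"
      have "half n p c = half n q (c + (- k) * int n)"
        by (simp add: half_def p algebra_simps)
      also have "\<dots> \<longleftrightarrow> half n q c = even k"
        by (simp only: antiperiodic_mult[OF antiperiodic_half[OF n]] even_minus)
      also have "half n q c \<longleftrightarrow> q \<le> c" using c q by (intro half_eq) auto
      finally show "F x c = half n p c" using x(2) c F_eq by auto
    qed
    then show ?thesis using x(1) by blast
  qed
  have win: "input_window B J f i \<subseteq> J - {block a1 a2 a3 (base i)}" if i: "i < n" for i
  proof (rule input_window_least(3))
    show "determines B J f i (J - {block a1 a2 a3 (base i)})"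
      unfolding determines_def
    proof (intro ballI impI)
      fix x y :: "nat \<Rightarrow> int" assume "\<forall>j\<in>J - {block a1 a2 a3 (base i)}. x j = y j"
      then have "block_letter a0 a1 a2 a3 x (base i) = block_letter a0 a1 a2 a3 y (base i)"
        unfolding J_def by (rule block_letter_local)
      then show "f x i = f y i"
        using i by (simp add: f_def word_def F_def antiperiodic_ext_def base_def)
    qed
  qed (auto simp: J_def)
  \<comment> \<open>Representatives below \<open>v\<close> belong to the arc after one more turn,
    those from \<open>u\<close> on directly.\<close>
  have block_arc: "i \<in> arc n u (v + int n)"
    if "i < n" "base i < v \<or> u \<le> base i" "u \<le> a0 + int n" "a0 \<le> v" for i u v
  proof -
    have i: "i = nat (base i mod int n)" "i = nat ((base i + int n) mod int n)"
      using that(1) by (simp_all add: base_def mod_simps)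
    show ?thesis
    proof (cases "base i < v")
      case True
      then show ?thesis unfolding arc_def
        using i(2) base[of i] that(3) by (intro CollectI exI[of _ "base i + int n"]) auto
    next
      case False
      then show ?thesis unfolding arc_def
        using i(1) base[of i] that(2,4) by (intro CollectI exI[of _ "base i"]) auto
    qed
  qed
  have cc: "communication_complex {0..<n} B J f \<subseteq> complex_of {arc n a1 (a0 + int n),
      arc n a2 (a1 + int n), arc n a3 (a2 + int n), arc n a0 a3}"
  proof
    fix S assume "S \<in> communication_complex {0..<n} B J f"
    then obtain j where S: "S \<subseteq> {0..<n}" and j: "j \<in> J" "\<And>i. i \<in> S \<Longrightarrow> j \<in> input_window B J f i"
      by (auto simp: communication_complex_def)
    have nb: "i < n \<and> block a1 a2 a3 (base i) \<noteq> j" if "i \<in> S" for i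
    proof -
      have i: "i < n" using S that by auto
      then show ?thesis using subsetD[OF win[OF i] j(2)[OF that]] by blast
    qed
    have sub: "S \<subseteq> arc n u (v + int n)"
      if "\<And>i. block a1 a2 a3 (base i) \<noteq> j \<Longrightarrow> base i < v \<or> u \<le> base i" "u \<le> a0 + int n" "a0 \<le> v"
      for u v
      using block_arc[of _ v u] nb that by blast
    have "j = 0 \<or> j = 1 \<or> j = 2 \<or> j = 3" using j(1) by (auto simp: J_def)
    moreover have "S \<subseteq> arc n a1 (a0 + int n)" if "j = 0"
      by (rule sub) (use a base that in \<open>auto simp: block_def split: if_splits\<close>)
    moreover have "S \<subseteq> arc n a2 (a1 + int n)" if "j = 1"
      by (rule sub) (use a base that in \<open>auto simp: block_def split: if_splits\<close>)
    moreover have "S \<subseteq> arc n a3 (a2 + int n)" if "j = 2"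
      by (rule sub) (use a base that in \<open>auto simp: block_def split: if_splits\<close>)
    moreover have "S \<subseteq> arc n (a0 + int n) (a3 + int n)" if "j = 3"
      by (rule sub) (use a base that in \<open>auto simp: block_def split: if_splits\<close>)
    ultimately show "S \<in> complex_of {arc n a1 (a0 + int n),
      arc n a2 (a1 + int n), arc n a3 (a2 + int n), arc n a0 a3}"
      unfolding complex_of_def arc_shift by blast
  qed
  show ?thesis
  proof (rule generatesI[OF _ _ _ _ cc])
    show "f \<in> (J \<rightarrow>\<^sub>E B) \<rightarrow> ({0..<n} \<rightarrow>\<^sub>E {0, 1})" by (auto simp: f_def word_def)
    show "f ` (J \<rightarrow>\<^sub>E B) = Mon n"
    proof (intro equalityI subsetI)
      fix z assume "z \<in> Mon n"
      then obtain p where "z = word n (half n p)" unfolding Mon_eq[OF n] by blast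
      with surj[of p] show "z \<in> f ` (J \<rightarrow>\<^sub>E B)" unfolding f_def by force
    qed (use in_Mon in blast)
  qed (simp_all add: B_def J_def)
qed

section \<open>Cyclic intervals as arcs, and assembly of the theorem\<close>

text \<open>\<open>k\<close> counts the turns that bring the excluded right end \<open>b\<close>
  into the range from \<open>a + 1\<close> to \<open>a + n\<close>.\<close>

lemma cyc_interval_eq_arc:
  assumes "a < b + k * int n" "b + k * int n \<le> a + int n"
  shows "cyc_interval n a (b - 1) = arc n a (b + k * int n)"
proof -
  have "(b - 1 - a) mod int n = (b - 1 - a + k * int n) mod int n" by simp
  also have "\<dots> = b - 1 - a + k * int n" using assms by (intro mod_pos_pos_trivial) auto
  finally have "a + (b - 1 - a) mod int n = b + k * int n - 1" by simp
  then show ?thesis by (auto simp: cyc_interval_def arc_def)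
qed

lemma simplicial_complex_on_complex_of:
  "\<Union>F \<subseteq> I \<Longrightarrow> simplicial_complex_on I (complex_of F)"
  unfolding simplicial_complex_on_def complex_of_def by blast

lemma complex_of_subset: "simplicial_complex_on I K \<Longrightarrow> F \<subseteq> K \<Longrightarrow> complex_of F \<subseteq> K"
  unfolding simplicial_complex_on_def complex_of_def by blast

theorem theorem6p13:
  fixes n :: nat and a0 a1 a2 a3 :: int
  assumes "n \<ge> 8"
    and "a1 - a0 \<ge> 2" and "a2 - a1 \<ge> 2" and "a3 - a2 \<ge> 2"
    and "a3 - a0 \<le> int n - 2"
  shows "minimal_generating {0..<n} {0, 1}
           (complex_of {cyc_interval n a3 (a2 - 1), cyc_interval n a2 (a1 - 1),
                        cyc_interval n a1 (a0 - 1), cyc_interval n a0 (a3 - 1)})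
           (Mon n)"
proof -
  have n: "n > 0" using assms(1) by simp
  let ?F = "{arc n a1 (a0 + int n), arc n a2 (a1 + int n), arc n a3 (a2 + int n), arc n a0 a3}"
  have "{cyc_interval n a3 (a2 - 1), cyc_interval n a2 (a1 - 1),
      cyc_interval n a1 (a0 - 1), cyc_interval n a0 (a3 - 1)} = ?F"
    using cyc_interval_eq_arc[of a3 a2 1 n] cyc_interval_eq_arc[of a2 a1 1 n]
      cyc_interval_eq_arc[of a1 a0 1 n] cyc_interval_eq_arc[of a0 a3 0 n] assms by auto
  moreover have "minimal_generating {0..<n} {0, 1} (complex_of ?F) (Mon n)"
    unfolding minimal_generating_def
  proof (intro conjI allI impI)
    show "simplicial_complex_on {0..<n} (complex_of ?F)"
      by (rule simplicial_complex_on_complex_of) (simp add: arc_subset[OF n])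
    show "generates {0..<n} {0, 1} (complex_of ?F) (Mon n)"
      using assms by (intro generates_four_arcs) auto
  next
    fix K assume "simplicial_complex_on {0..<n} K \<and> K \<subset> complex_of ?F"
    then have K: "simplicial_complex_on {0..<n} K" "K \<subseteq> complex_of ?F" "\<not> complex_of ?F \<subseteq> K"
      by auto
    \<comment> \<open>By downward closure, a subcomplex containing all four facets would be the
      whole complex.\<close>
    have "\<not> ?F \<subseteq> K" using complex_of_subset[OF K(1)] K(3) by blast
    then consider "arc n a1 (a0 + int n) \<notin> K" | "arc n a2 (a1 + int n) \<notin> K"
      | "arc n a3 (a2 + int n) \<notin> K" | "arc n a0 a3 \<notin> K" by blast
    then show "\<not> generates {0..<n} {0, 1} K (Mon n)"
    proof cases
      case 1
      show ?thesis by (rule facet_needed[OF _ _ _ _ K(2) 1]) (use assms in auto)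
    next
      case 2
      \<comment> \<open>The blocks are renamed cyclically, ends that wrap around being raised by
        \<open>n\<close>; \<open>arc_shift\<close> shows that the complex is unchanged.\<close>
      have "K \<subseteq> complex_of {arc n a2 (a1 + int n), arc n a3 (a2 + int n),
          arc n (a0 + int n) (a3 + int n), arc n a1 (a0 + int n)}"
        using K(2) by (simp only: arc_shift insert_commute)
      from facet_needed[OF _ _ _ _ this 2] show ?thesis using assms by auto
    next
      case 3
      have "K \<subseteq> complex_of {arc n a3 (a2 + int n), arc n (a0 + int n) (a3 + int n),
          arc n (a1 + int n) (a0 + int n + int n), arc n a2 (a1 + int n)}"
        using K(2) by (simp only: arc_shift insert_commute)
      from facet_needed[OF _ _ _ _ this 3] show ?thesis using assms by auto
    next
      case 4
      have "K \<subseteq> complex_of {arc n (a0 + int n) (a3 + int n), arc n (a1 + int n) (a0 + int n + int n),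
          arc n (a2 + int n) (a1 + int n + int n), arc n a3 (a2 + int n)}"
        using K(2) by (simp only: arc_shift insert_commute)
      moreover have "arc n (a0 + int n) (a3 + int n) \<notin> K" using 4 by (simp add: arc_shift)
      ultimately show ?thesis by (rule facet_needed[rotated 4]) (use assms in auto)
    qed
  qed
  ultimately show ?thesis by simp
qed

end
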